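(* There is an absolute constant $c>0$ such that for every $N\ge 1$ and every symmetric Boolean function $f:\{0,1\}^N\to\{0,1\}$ we have $D(f)\le c\, Q_2(f)^2$.
   Context: $f$ is symmetric if $f(X)$ depends only on the Hamming weight $|X|$ (number of 1s in $X$). Deterministic decision trees: $D(f)$ is the minimum, over all deterministic classical algorithms (decision trees) that compute $f(X)$ for every $X\in\{0,1\}^N$ by adaptively querying individual bits $x_i$ of $X$, of the worst-case number of queries (the depth of the tree). Quantum networks: the input $X=(x_0,\ldots,x_{N-1})\in\{0,1\}^N$ is given as a black-box. A quantum network with $T$ queries acts on $m$ qubits (for some $m$) and is a sequence of unitary transformations $U_0,O,U_1,O,\ldots,U_{T-1},O,U_T$ applied in this order to the initial state $|0\rangle$, where the $U_j$ are arbitrary unitaries on $m$ qubits not depending on $X$, and the query $O$ (depending on $X$) maps each basis state $|i,b,z\rangle$ to $|i,b\oplus x_i,z\rangle$; here $i$ consists of $\lceil\log_2 N\rceil$ bits, $b$ is one bit, and $z$ consists of the remaining $m-\lceil\log_2 N\rceil-1$ bits (if $i\ge N$, the query leaves the basis state unchanged). The output is the value obtained by measuring the rightmost bit of the final state in the computational basis. The network computes $f$ with bounded error if for every $X\in\{0,1\}^N$ the output equals $f(X)$ with probability at least $2/3$. $Q_2(f)$ is the minimum $T$ such that some quantum network with $T$ queries computes $f$ with bounded error. *)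

theory Defs
  imports Complex_Main "Jordan_Normal_Form.Schur_Decomposition"
begin

text \<open>An input X in {0,1}^N is a \<^typ>\<open>bool list\<close> of length N, and a Boolean function on
  {0,1}^N is a function on \<^typ>\<open>bool list\<close>; its values on lists of other lengths are never used.\<close>

definition hamming_weight :: "bool list \<Rightarrow> nat" where
  "hamming_weight X = card {i. i < length X \<and> X ! i}"

definition symmetric_fun :: "nat \<Rightarrow> (bool list \<Rightarrow> bool) \<Rightarrow> bool" where
  "symmetric_fun N f \<longleftrightarrow>
     (\<forall>X Y. length X = N \<longrightarrow> length Y = N \<longrightarrow> hamming_weight X = hamming_weight Y \<longrightarrow> f X = f Y)"


datatype dtree = Leaf bool | Query nat dtree dtree

primrec dt_eval :: "dtree \<Rightarrow> bool list \<Rightarrow> bool" where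
  "dt_eval (Leaf b) X = b"
| "dt_eval (Query i l r) X = (if X ! i then dt_eval r X else dt_eval l X)"

primrec dt_depth :: "dtree \<Rightarrow> nat" where
  "dt_depth (Leaf b) = 0"
| "dt_depth (Query i l r) = Suc (max (dt_depth l) (dt_depth r))"

primrec dt_queries :: "dtree \<Rightarrow> nat set" where
  "dt_queries (Leaf b) = {}"
| "dt_queries (Query i l r) = insert i (dt_queries l \<union> dt_queries r)"

definition dt_computes :: "nat \<Rightarrow> (bool list \<Rightarrow> bool) \<Rightarrow> dtree \<Rightarrow> bool" where
  "dt_computes N f t \<longleftrightarrow>
     dt_queries t \<subseteq> {..<N} \<and> (\<forall>X. length X = N \<longrightarrow> dt_eval t X = f X)"

definition D :: "nat \<Rightarrow> (bool list \<Rightarrow> bool) \<Rightarrow> nat" where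
  "D N f = (LEAST d. \<exists>t. dt_computes N f t \<and> dt_depth t = d)"

text \<open>The minimum defining \<^const>\<open>D\<close> is over a nonempty set: query all bits in order.\<close>

primrec full_tree :: "(bool list \<Rightarrow> bool) \<Rightarrow> nat \<Rightarrow> bool list \<Rightarrow> dtree" where
  "full_tree f 0 xs = Leaf (f xs)"
| "full_tree f (Suc n) xs =
     Query (length xs) (full_tree f n (xs @ [False])) (full_tree f n (xs @ [True]))"

lemma dt_computes_exists: "\<exists>t. dt_computes N f t \<and> dt_depth t = N"
proof -
  have q: "dt_queries (full_tree f n xs) \<subseteq> {..<length xs + n}" for n xs
    by (induction n arbitrary: xs) (simp, fastforce)
  have d: "dt_depth (full_tree f n xs) = n" for n xs
    by (induction n arbitrary: xs) auto
  have e: "dt_eval (full_tree f n xs) (xs @ ys) = f (xs @ ys)" if "length ys = n" for n xs ys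
    using that
  proof (induction n arbitrary: xs ys)
    case 0
    then show ?case by simp
  next
    case (Suc n)
    then obtain y zs where ys: "ys = y # zs" and len: "length zs = n"
      by (cases ys) auto
    show ?case
      using Suc.IH[OF len, of "xs @ [y]"] by (cases y) (simp_all add: ys nth_append)
  qed
  have "dt_computes N f (full_tree f N [])"
    unfolding dt_computes_def using q[of N "[]"] e[of _ N "[]"] by auto
  then show ?thesis using d by blast
qed


text \<open>
  The basis states of m qubits are numbered by the s < 2^m, the leftmost qubit being the most
  significant binary digit.  A basis state |i,b,z> whose index register i has k bits thus has number
  s with i = \<^term>\<open>drop_bit (m - k) s\<close>; the bit b is bit m - k - 1 of s, and the rightmost
  qubit is bit 0 of s.\<close>

definition index_bits :: "nat \<Rightarrow> nat" where
  "index_bits N = nat \<lceil>log 2 (real N)\<rceil>"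

definition query_basis :: "nat \<Rightarrow> bool list \<Rightarrow> nat \<Rightarrow> nat" where
  "query_basis m X s =
     (let k = index_bits (length X); i = drop_bit (m - k) s
      in if i < length X \<and> X ! i then flip_bit (m - k - 1) s else s)"

definition query_op :: "nat \<Rightarrow> bool list \<Rightarrow> complex mat" where
  "query_op m X = mat (2 ^ m) (2 ^ m) (\<lambda>(r, s). if r = query_basis m X s then 1 else 0)"

definition unitary_op :: "nat \<Rightarrow> complex mat \<Rightarrow> bool" where
  "unitary_op n A \<longleftrightarrow> A \<in> carrier_mat n n \<and> A * mat_adjoint A = 1\<^sub>m n \<and> mat_adjoint A * A = 1\<^sub>m n"

text \<open>A network with T queries is given by its number m of qubits and the unitaries
  U 0, ..., U T; the values U j for j > T are irrelevant.\<close>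

definition quantum_network :: "nat \<Rightarrow> nat \<Rightarrow> nat \<Rightarrow> (nat \<Rightarrow> complex mat) \<Rightarrow> bool" where
  "quantum_network N T m U \<longleftrightarrow>
     index_bits N + 1 \<le> m \<and> (\<forall>j\<le>T. unitary_op (2 ^ m) (U j))"

primrec network_state :: "nat \<Rightarrow> (nat \<Rightarrow> complex mat) \<Rightarrow> bool list \<Rightarrow> nat \<Rightarrow> complex vec" where
  "network_state m U X 0 = U 0 *\<^sub>v unit_vec (2 ^ m) 0"
| "network_state m U X (Suc t) = U (Suc t) *\<^sub>v (query_op m X *\<^sub>v network_state m U X t)"

definition output_prob ::
    "nat \<Rightarrow> (nat \<Rightarrow> complex mat) \<Rightarrow> nat \<Rightarrow> bool list \<Rightarrow> bool \<Rightarrow> real" where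
  "output_prob m U T X b =
     (\<Sum>s | s < 2 ^ m \<and> bit s 0 = b. (cmod (network_state m U X T $ s))\<^sup>2)"

definition computes_bounded_error ::
    "nat \<Rightarrow> (bool list \<Rightarrow> bool) \<Rightarrow> nat \<Rightarrow> nat \<Rightarrow> (nat \<Rightarrow> complex mat) \<Rightarrow> bool" where
  "computes_bounded_error N f T m U \<longleftrightarrow>
     quantum_network N T m U \<and> (\<forall>X. length X = N \<longrightarrow> output_prob m U T X (f X) \<ge> 2 / 3)"

definition Q2 :: "nat \<Rightarrow> (bool list \<Rightarrow> bool) \<Rightarrow> nat" where
  "Q2 N f = (LEAST T. \<exists>m U. computes_bounded_error N f T m U)"

end

theory Submission
  imports Defs "HOL-Analysis.L2_Norm"
begin

text \<open>
  A nonconstant symmetric f changes value between two neighbouring Hamming weights, so some input X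
  has a set I of at least N/2 bits each of whose flips changes f.  A T-query network must separate X
  from all these neighbours.  By the hybrid argument of Bennett, Bernstein, Brassard and Vazirani,
  flipping bit i moves the final state by at most twice the sum over the T queries of the norm of
  the component of the state on X that queries i.  These components are orthogonal for different i,
  so by Cauchy-Schwarz their norms add up to at most sqrt |I| in each query.  As each final state
  has to move by a constant, |I| = O(T sqrt |I|), so N = O(T^2), while D(f) is at most N.
\<close>

section \<open>Euclidean norm of complex vectors and its invariance under unitaries\<close>

definition vec_norm :: "complex vec \<Rightarrow> real" where
  "vec_norm v = L2_set (\<lambda>s. cmod (v $ s)) {..<dim_vec v}"

lemma vec_norm_nonneg [simp]: "0 \<le> vec_norm v"
  by (simp add: vec_norm_def)

text \<open>Invariance under unitaries is an inner-product fact. This identity carries it over to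
  the real-valued \<open>L2_set\<close> form, in which the triangle and Cauchy-Schwarz inequalities
  are available.\<close>

lemma vec_norm_square: "complex_of_real ((vec_norm v)\<^sup>2) = conjugate v \<bullet> v"
  unfolding vec_norm_def L2_set_def scalar_prod_def
  by (auto simp: sum_nonneg complex_norm_square atLeast0LessThan mult.commute
      simp del: of_real_power intro!: sum.cong)

lemma vec_norm_unit_vec: "s < n \<Longrightarrow> vec_norm (unit_vec n s) = 1"
proof -
  assume "s < n"
  then have "(\<Sum>r<n. (cmod (unit_vec n s $ r))\<^sup>2) = (\<Sum>r<n. if r = s then 1 else 0)"
    by (intro sum.cong) auto
  then show ?thesis using \<open>s < n\<close> by (simp add: vec_norm_def L2_set_def)
qed

lemma vec_norm_triangle:
  assumes "u \<in> carrier_vec n" "v \<in> carrier_vec n" "w \<in> carrier_vec n"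
  shows "vec_norm (u - w) \<le> vec_norm (u - v) + vec_norm (v - w)"
proof -
  have "L2_set (\<lambda>s. cmod ((u - w) $ s)) {..<n}
      \<le> L2_set (\<lambda>s. cmod ((u - v) $ s) + cmod ((v - w) $ s)) {..<n}"
    using assms by (intro L2_set_mono) (auto intro: norm_diff_triangle_le)
  also have "\<dots> \<le> L2_set (\<lambda>s. cmod ((u - v) $ s)) {..<n} + L2_set (\<lambda>s. cmod ((v - w) $ s)) {..<n}"
    by (rule L2_set_triangle_ineq)
  finally show ?thesis using assms by (simp add: vec_norm_def)
qed

lemma vec_norm_unitary:
  assumes "unitary_op n A" "v \<in> carrier_vec n"
  shows "vec_norm (A *\<^sub>v v) = vec_norm v"
proof -
  have A: "A \<in> carrier_mat n n" and I: "mat_adjoint A * A = 1\<^sub>m n"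
    using assms(1) by (auto simp: unitary_op_def)
  have adj: "mat_adjoint A \<in> carrier_mat n n"
    using A by (auto simp: mat_adjoint_def)
  \<comment> \<open>The product \<open>\<bullet>\<close> does not conjugate, so moving
    \<open>A\<close> to the other factor yields its transpose; on a conjugated vector the transpose
    acts as the conjugate of the adjoint.\<close>
  have conj: "transpose_mat A *\<^sub>v conjugate w = conjugate (mat_adjoint A *\<^sub>v w)"
    if "w \<in> carrier_vec n" for w
    using A that by (intro eq_vecI) (auto simp: mat_adjoint_def scalar_prod_def)
  have "conjugate (A *\<^sub>v v) \<bullet> (A *\<^sub>v v) = (transpose_mat A *\<^sub>v conjugate (A *\<^sub>v v)) \<bullet> v"
    using A assms(2) by (subst transpose_vec_mult_scalar[of A n n]) auto
  also have "transpose_mat A *\<^sub>v conjugate (A *\<^sub>v v) = conjugate ((mat_adjoint A * A) *\<^sub>v v)"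
    using A adj assms(2) by (subst conj) (auto simp: assoc_mult_mat_vec[OF adj A])
  also have "\<dots> = conjugate v"
    using assms(2) by (simp add: I)
  finally have "complex_of_real ((vec_norm (A *\<^sub>v v))\<^sup>2) = complex_of_real ((vec_norm v)\<^sup>2)"
    by (simp only: vec_norm_square)
  then have "(vec_norm (A *\<^sub>v v))\<^sup>2 = (vec_norm v)\<^sup>2"
    by (simp only: of_real_eq_iff)
  then show ?thesis by simp
qed

section \<open>Permutation matrices: the query and all unitaries of the witness network have this
  form\<close>

definition perm_mat :: "nat \<Rightarrow> (nat \<Rightarrow> nat) \<Rightarrow> complex mat" where
  "perm_mat n \<pi> = mat n n (\<lambda>(r, s). if r = \<pi> s then 1 else 0)"

lemma perm_mat_carrier [simp]: "perm_mat n \<pi> \<in> carrier_mat n n"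
  by (simp add: perm_mat_def)

lemma perm_mat_mult_vec:
  assumes "bij_betw \<pi> {..<n} {..<n}" "v \<in> carrier_vec n" "s < n"
  shows "(perm_mat n \<pi> *\<^sub>v v) $ (\<pi> s) = v $ s"
proof -
  have "\<pi> s < n" using assms by (auto simp: bij_betw_def)
  then have "(perm_mat n \<pi> *\<^sub>v v) $ (\<pi> s) = (\<Sum>r<n. (if \<pi> s = \<pi> r then 1 else 0) * v $ r)"
    using assms(2) by (auto simp: perm_mat_def scalar_prod_def atLeast0LessThan intro!: sum.cong)
  also have "\<dots> = (\<Sum>r<n. if r = s then v $ r else 0)"
    using assms by (intro sum.cong) (auto simp: bij_betw_def inj_on_def)
  finally show ?thesis using assms(3) by simp
qed

lemma perm_mat_unit_vec:
  assumes "bij_betw \<pi> {..<n} {..<n}" "s < n"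
  shows "perm_mat n \<pi> *\<^sub>v unit_vec n s = unit_vec n (\<pi> s)"
proof (intro eq_vecI)
  fix r assume r: "r < dim_vec (unit_vec n (\<pi> s))"
  then obtain q where q: "q < n" "r = \<pi> q" using assms(1) by (auto simp: bij_betw_def)
  have "\<pi> q = \<pi> s \<longleftrightarrow> q = s" using assms q by (auto simp: bij_betw_def inj_on_def)
  then show "(perm_mat n \<pi> *\<^sub>v unit_vec n s) $ r = unit_vec n (\<pi> s) $ r"
    using assms q r by (auto simp: perm_mat_mult_vec unit_vec_def)
qed (simp add: perm_mat_def)

lemma unitary_perm_mat:
  assumes "bij_betw \<pi> {..<n} {..<n}"
  shows "unitary_op n (perm_mat n \<pi>)"
proof -
  let ?A = "perm_mat n \<pi>"
  have adj: "mat_adjoint ?A \<in> carrier_mat n n"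
    by (auto simp: mat_adjoint_def perm_mat_def)
  have "mat_adjoint ?A * ?A = 1\<^sub>m n"
  proof (rule eq_matI)
    fix i j assume "i < dim_row (1\<^sub>m n :: complex mat)" "j < dim_col (1\<^sub>m n :: complex mat)"
    then have ij: "i < n" "j < n" by auto
    then have "(mat_adjoint ?A * ?A) $$ (i, j)
        = (\<Sum>r<n. cnj (?A $$ (r, i)) * ?A $$ (r, j))"
      by (simp add: perm_mat_def mat_adjoint_def mat_of_rows_def scalar_prod_def atLeast0LessThan)
    also have "\<dots> = (\<Sum>r<n. if r = \<pi> j then (if \<pi> i = \<pi> j then 1 else 0) else 0)"
      using ij by (intro sum.cong) (auto simp: perm_mat_def)
    finally show "(mat_adjoint ?A * ?A) $$ (i, j) = 1\<^sub>m n $$ (i, j)"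
      using ij assms by (auto simp: bij_betw_def inj_on_def)
  qed (use adj in \<open>auto simp: perm_mat_def\<close>)
  moreover from this have "?A * mat_adjoint ?A = 1\<^sub>m n"
    by (rule mat_mult_left_right_inverse[OF adj perm_mat_carrier])
  ultimately show ?thesis by (simp add: unitary_op_def)
qed

section \<open>The query as a permutation of the basis states\<close>

lemma query_basis_less:
  assumes "index_bits (length X) + 1 \<le> m" "s < 2 ^ m"
  shows "query_basis m X s < 2 ^ m"
proof -
  \<comment> \<open>The flipped position lies below \<open>m\<close>, so truncation to
    \<open>m\<close> bits still fixes the number.\<close>
  have "take_bit m (flip_bit (m - index_bits (length X) - 1) s)
      = flip_bit (m - index_bits (length X) - 1) s"
    using assms by (auto simp: take_bit_flip_bit_eq take_bit_nat_eq_self)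
  then have "flip_bit (m - index_bits (length X) - 1) s < 2 ^ m"
    by (simp only: take_bit_nat_eq_self_iff)
  then show ?thesis using assms by (simp add: query_basis_def Let_def)
qed

text \<open>The answer bit sits directly below the index register, so flipping it leaves the
  register alone.\<close>

lemma query_basis_index:
  assumes "index_bits (length X) + 1 \<le> m"
  shows "drop_bit (m - index_bits (length X)) (query_basis m X s)
       = drop_bit (m - index_bits (length X)) s"
proof -
  \<comment> \<open>Positivity matters: for \<open>n = 0\<close> the truncated \<open>n - 1\<close>
    is 0, and \<open>drop_bit 0\<close> keeps the flipped bit.\<close>
  have "drop_bit n (flip_bit (n - 1) s) = drop_bit n s" if "0 < n" for n
    by (rule bit_eqI) (use that in \<open>auto simp: bit_drop_bit_eq bit_flip_bit_iff\<close>)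
  from this[of "m - index_bits (length X)"] show ?thesis
    using assms by (simp add: query_basis_def Let_def)
qed

text \<open>The first application keeps the index, so the second one consults the same input bit and
  undoes the flip.\<close>

lemma query_basis_involution:
  assumes "index_bits (length X) + 1 \<le> m"
  shows "query_basis m X (query_basis m X s) = s"
proof -
  have "flip_bit n (flip_bit n s) = s" for n
    by (rule bit_eqI) (auto simp: bit_flip_bit_iff)
  then show ?thesis
    using query_basis_index[OF assms, of s]
    by (simp add: query_basis_def Let_def split: if_splits)
qed

lemma bij_query_basis:
  assumes "index_bits (length X) + 1 \<le> m"
  shows "bij_betw (query_basis m X) {..<2 ^ m} {..<2 ^ m}"
  by (rule bij_betw_byWitness[where f' = "query_basis m X"])
    (use query_basis_involution[OF assms] query_basis_less[OF assms] in auto)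

lemma query_op_perm_mat: "query_op m X = perm_mat (2 ^ m) (query_basis m X)"
  by (simp add: query_op_def perm_mat_def)

lemma query_op_carrier [simp]: "query_op m X \<in> carrier_mat (2 ^ m) (2 ^ m)"
  by (simp add: query_op_perm_mat)

lemma unitary_query_op:
  "index_bits (length X) + 1 \<le> m \<Longrightarrow> unitary_op (2 ^ m) (query_op m X)"
  by (simp add: query_op_perm_mat unitary_perm_mat bij_query_basis)

text \<open>As the query is its own inverse on basis states, an entry of the result can be read off
  without an inverse permutation.\<close>

lemma query_op_mult_vec:
  assumes "index_bits (length X) + 1 \<le> m" "v \<in> carrier_vec (2 ^ m)" "r < 2 ^ m"
  shows "(query_op m X *\<^sub>v v) $ r = v $ query_basis m X r"
  using perm_mat_mult_vec[OF bij_query_basis[OF assms(1)] assms(2) query_basis_less[OF assms(1,3)]]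
  by (simp only: query_op_perm_mat query_basis_involution[OF assms(1)])

section \<open>The part of a state that queries a given bit\<close>

definition query_set :: "nat \<Rightarrow> nat \<Rightarrow> nat \<Rightarrow> nat set" where
  "query_set m k i = {s. s < 2 ^ m \<and> drop_bit (m - k) s = i}"

lemma finite_query_set [simp]: "finite (query_set m k i)"
  by (simp add: query_set_def)

text \<open>This is the norm of the projection of \<open>v\<close> to the span of the basis states
  whose index register holds \<open>i\<close>; only this component can notice a change of input bit
  \<open>i\<close>.\<close>

definition query_weight :: "nat \<Rightarrow> nat \<Rightarrow> nat \<Rightarrow> complex vec \<Rightarrow> real" where
  "query_weight m k i v = L2_set (\<lambda>s. cmod (v $ s)) (query_set m k i)"

lemma sum_query_weight_le:
  assumes "v \<in> carrier_vec (2 ^ m)" "finite I"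
  shows "(\<Sum>i\<in>I. query_weight m k i v) \<le> sqrt (card I) * vec_norm v"
proof -
  \<comment> \<open>The factor 1 sets up Cauchy-Schwarz against the constant vector, which yields
    \<open>sqrt (card I)\<close>.\<close>
  have "(\<Sum>i\<in>I. query_weight m k i v) = (\<Sum>i\<in>I. \<bar>1\<bar> * \<bar>query_weight m k i v\<bar>)"
    by (simp add: query_weight_def)
  also have "\<dots> \<le> L2_set (\<lambda>i. 1) I * L2_set (\<lambda>i. query_weight m k i v) I"
    by (rule L2_set_mult_ineq)
  also have "L2_set (\<lambda>i. 1) I = sqrt (card I)"
    by (simp add: L2_set_def)
  also have "L2_set (\<lambda>i. query_weight m k i v) I
      = sqrt (\<Sum>i\<in>I. \<Sum>s\<in>query_set m k i. (cmod (v $ s))\<^sup>2)"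
    by (simp add: L2_set_def query_weight_def sum_nonneg)
  also have "(\<Sum>i\<in>I. \<Sum>s\<in>query_set m k i. (cmod (v $ s))\<^sup>2)
      = (\<Sum>s\<in>(\<Union>i\<in>I. query_set m k i). (cmod (v $ s))\<^sup>2)"
    using assms(2) by (subst sum.UNION_disjoint) (auto simp: query_set_def)
  also have "\<dots> \<le> (\<Sum>s<2 ^ m. (cmod (v $ s))\<^sup>2)"
    by (intro sum_mono2) (auto simp: query_set_def)
  finally show ?thesis
    using assms(1) by (simp add: vec_norm_def L2_set_def mult_left_mono)
qed

text \<open>The two queries agree on all basis states whose index is not \<open>i\<close>. On the
  remaining ones the triangle inequality bounds the difference by two terms, each equal to the query
  weight; hence the factor 2.\<close>

lemma query_op_diff_le:
  assumes m: "index_bits (length X) + 1 \<le> m" and len: "length Y = length X"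
    and agree: "\<And>j. j < length X \<Longrightarrow> j \<noteq> i \<Longrightarrow> X ! j = Y ! j"
    and v: "v \<in> carrier_vec (2 ^ m)"
  shows "vec_norm (query_op m X *\<^sub>v v - query_op m Y *\<^sub>v v)
       \<le> 2 * query_weight m (index_bits (length X)) i v"
proof -
  let ?S = "query_set m (index_bits (length X)) i"
  \<comment> \<open>A query keeps the index register, so it merely permutes
    \<open>?S\<close>.\<close>
  have weight: "L2_set (\<lambda>s. cmod (v $ query_basis m Z s)) ?S = L2_set (\<lambda>s. cmod (v $ s)) ?S"
    if "length Z = length X" for Z
  proof -
    have mZ: "index_bits (length Z) + 1 \<le> m" using m that by simp
    have "bij_betw (query_basis m Z) ?S ?S"
      by (rule bij_betw_byWitness[where f' = "query_basis m Z"])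
        (use query_basis_less[OF mZ] query_basis_index[OF mZ] query_basis_involution[OF mZ] that
          in \<open>auto simp: query_set_def\<close>)
    then show ?thesis
      unfolding L2_set_def by (subst sum.reindex_bij_betw) auto
  qed
  \<comment> \<open>Either the index is below N and both inputs have the same bit there, or it is
    out of range and both queries do nothing.\<close>
  have outside: "query_basis m X s = query_basis m Y s" if "s < 2 ^ m" "s \<notin> ?S" for s
    using that agree len by (auto simp: query_basis_def Let_def query_set_def)
  have "vec_norm (query_op m X *\<^sub>v v - query_op m Y *\<^sub>v v)
      = L2_set (\<lambda>s. cmod (v $ query_basis m X s - v $ query_basis m Y s)) {..<2 ^ m}"
    using query_op_mult_vec[OF _ v] m len
    by (auto simp: vec_norm_def query_op_def L2_set_def intro!: sum.cong arg_cong[of _ _ sqrt])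
  also have "\<dots> = L2_set (\<lambda>s. cmod (v $ query_basis m X s - v $ query_basis m Y s)) ?S"
    unfolding L2_set_def
    by (rule arg_cong[of _ _ sqrt], rule sum.mono_neutral_right)
      (auto simp: outside, auto simp: query_set_def)
  also have "\<dots> \<le> L2_set (\<lambda>s. cmod (v $ query_basis m X s) + cmod (v $ query_basis m Y s)) ?S"
    by (intro L2_set_mono) (auto intro: norm_triangle_ineq4)
  also have "\<dots> \<le> L2_set (\<lambda>s. cmod (v $ query_basis m X s)) ?S
      + L2_set (\<lambda>s. cmod (v $ query_basis m Y s)) ?S"
    by (rule L2_set_triangle_ineq)
  finally show ?thesis
    using weight[of X] weight[of Y] len by (simp add: query_weight_def)
qed

section \<open>The hybrid argument for the states of a network\<close>

lemma network_state_carrier: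
  assumes "quantum_network N T m U" "t \<le> T"
  shows "network_state m U X t \<in> carrier_vec (2 ^ m)"
  using assms(2)
proof (cases t)
  case (Suc t')
  have "U t \<in> carrier_mat (2 ^ m) (2 ^ m)"
    using assms by (auto simp: quantum_network_def unitary_op_def)
  then show ?thesis by (auto simp: Suc carrier_vecI)
next
  case 0
  have "U 0 \<in> carrier_mat (2 ^ m) (2 ^ m)"
    using assms by (auto simp: quantum_network_def unitary_op_def)
  then show ?thesis by (auto simp: 0)
qed

lemma vec_norm_network_state:
  assumes "quantum_network (length X) T m U" "t \<le> T"
  shows "vec_norm (network_state m U X t) = 1"
  using assms(2)
proof (induction t)
  case 0
  then show ?case
    using assms(1)
    by (simp add: quantum_network_def vec_norm_unitary[where n = "2 ^ m"] vec_norm_unit_vec)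
next
  case (Suc t)
  then have c: "network_state m U X t \<in> carrier_vec (2 ^ m)"
    using network_state_carrier[OF assms(1), of t] by simp
  then have "vec_norm (query_op m X *\<^sub>v network_state m U X t) = 1"
    using Suc assms(1) by (subst vec_norm_unitary[OF unitary_query_op]) (auto simp: quantum_network_def)
  moreover have "query_op m X *\<^sub>v network_state m U X t \<in> carrier_vec (2 ^ m)"
    using c by (rule mult_mat_vec_carrier[OF query_op_carrier])
  ultimately show ?case
    using Suc.prems assms(1)
    by (simp add: quantum_network_def vec_norm_unitary[where n = "2 ^ m"])
qed

lemma network_state_diff_le:
  assumes net: "quantum_network (length X) T m U" and len: "length Y = length X"
    and agree: "\<And>j. j < length X \<Longrightarrow> j \<noteq> i \<Longrightarrow> X ! j = Y ! j" and "t \<le> T"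
  shows "vec_norm (network_state m U X t - network_state m U Y t)
       \<le> 2 * (\<Sum>t'<t. query_weight m (index_bits (length X)) i (network_state m U X t'))"
  using \<open>t \<le> T\<close>
proof (induction t)
  case 0
  have "network_state m U X 0 \<in> carrier_vec (2 ^ m)"
    by (rule network_state_carrier[OF net]) simp
  then show ?case by (simp add: vec_norm_def L2_set_def)
next
  case (Suc t)
  let ?x = "network_state m U X t" and ?y = "network_state m U Y t"
  let ?OX = "query_op m X" and ?OY = "query_op m Y"
  have x: "?x \<in> carrier_vec (2 ^ m)" and y: "?y \<in> carrier_vec (2 ^ m)"
    using network_state_carrier[OF net] Suc.prems by auto
  have m: "index_bits (length X) + 1 \<le> m" and U: "unitary_op (2 ^ m) (U (Suc t))"
    using net Suc.prems by (auto simp: quantum_network_def)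
  have Uc: "U (Suc t) \<in> carrier_mat (2 ^ m) (2 ^ m)"
    using U by (simp add: unitary_op_def)
  have q: "query_op m Z *\<^sub>v z \<in> carrier_vec (2 ^ m)" if "z \<in> carrier_vec (2 ^ m)" for Z z
    using that by (rule mult_mat_vec_carrier[OF query_op_carrier])
  have "vec_norm (network_state m U X (Suc t) - network_state m U Y (Suc t))
      = vec_norm (U (Suc t) *\<^sub>v (?OX *\<^sub>v ?x - ?OY *\<^sub>v ?y))"
    using q x y Uc by (simp add: mult_minus_distrib_mat_vec)
  also have "\<dots> = vec_norm (?OX *\<^sub>v ?x - ?OY *\<^sub>v ?y)"
    using q x y by (intro vec_norm_unitary[OF U]) simp
  \<comment> \<open>The hybrid \<open>?OY *\<^sub>v ?x\<close> splits the error into a new part,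
    measured on the run on \<open>X\<close> alone, and the old difference, which the unitary query
    preserves.\<close>
  also have "\<dots> \<le> vec_norm (?OX *\<^sub>v ?x - ?OY *\<^sub>v ?x) + vec_norm (?OY *\<^sub>v ?x - ?OY *\<^sub>v ?y)"
    using q x y by (intro vec_norm_triangle) auto
  also have "?OY *\<^sub>v ?x - ?OY *\<^sub>v ?y = ?OY *\<^sub>v (?x - ?y)"
    using x y by (simp add: mult_minus_distrib_mat_vec[OF query_op_carrier])
  also have "vec_norm (?OY *\<^sub>v (?x - ?y)) = vec_norm (?x - ?y)"
    using x y m len by (intro vec_norm_unitary[OF unitary_query_op]) auto
  also have "vec_norm (?OX *\<^sub>v ?x - ?OY *\<^sub>v ?x)
      \<le> 2 * query_weight m (index_bits (length X)) i ?x"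
    using m len agree x by (rule query_op_diff_le)
  finally show ?case using Suc by simp
qed

section \<open>Output probabilities and the lower bound from sensitivity\<close>

lemma output_prob_add:
  assumes "quantum_network (length X) T m U"
  shows "output_prob m U T X b + output_prob m U T X (\<not> b) = 1"
proof -
  have "network_state m U X T \<in> carrier_vec (2 ^ m)"
    using network_state_carrier[OF assms] by simp
  then have "(\<Sum>s<2 ^ m. (cmod (network_state m U X T $ s))\<^sup>2) = 1"
    using vec_norm_network_state[OF assms, of T] by (simp add: vec_norm_def L2_set_def)
  moreover have "output_prob m U T X b + output_prob m U T X (\<not> b)
      = (\<Sum>s\<in>{s. s < 2 ^ m \<and> bit s 0 = b} \<union> {s. s < 2 ^ m \<and> bit s 0 = (\<not> b)}.
          (cmod (network_state m U X T $ s))\<^sup>2)"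
    unfolding output_prob_def by (rule sum.union_disjoint[symmetric]) auto
  moreover have "{s. s < 2 ^ m \<and> bit s 0 = b} \<union> {s. s < 2 ^ m \<and> bit s 0 = (\<not> b)} = {..<2 ^ m :: nat}"
    by auto
  ultimately show ?thesis by simp
qed

text \<open>Each probability is the square of the norm of the projected final state. A difference of
  squares factors into the difference of these norms, at most the distance of the states, and their
  sum, at most 2.\<close>

lemma output_prob_diff_le:
  assumes net: "quantum_network (length X) T m U" and len: "length Y = length X"
  shows "output_prob m U T X b - output_prob m U T Y b
       \<le> 2 * vec_norm (network_state m U X T - network_state m U Y T)"
proof -
  let ?x = "network_state m U X T" and ?y = "network_state m U Y T"
  let ?S = "{s. s < 2 ^ m \<and> bit s 0 = b}"
  let ?n = "\<lambda>v. L2_set (\<lambda>s. cmod (v $ s)) ?S"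
  have netY: "quantum_network (length Y) T m U" using net len by simp
  have x: "?x \<in> carrier_vec (2 ^ m)" and y: "?y \<in> carrier_vec (2 ^ m)"
    using network_state_carrier[OF net] by auto
  have part: "?n v \<le> vec_norm v" if "v \<in> carrier_vec (2 ^ m)" for v
    unfolding vec_norm_def L2_set_def using that by (auto intro!: sum_mono2)
  have "?n ?x \<le> L2_set (\<lambda>s. cmod ((?x - ?y) $ s) + cmod (?y $ s)) ?S"
    using x y by (intro L2_set_mono) (auto simp: norm_triangle_sub add.commute)
  also have "\<dots> \<le> ?n (?x - ?y) + ?n ?y"
    by (rule L2_set_triangle_ineq)
  also have "?n (?x - ?y) \<le> vec_norm (?x - ?y)"
    using x y by (intro part) simp
  finally have diff: "?n ?x - ?n ?y \<le> vec_norm (?x - ?y)" by simp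
  have "?n ?x + ?n ?y \<le> 2"
    using part[OF x] part[OF y] vec_norm_network_state[OF net, of T]
      vec_norm_network_state[OF netY, of T] by simp
  moreover have "0 \<le> ?n ?x + ?n ?y" by simp
  ultimately have "(?n ?x - ?n ?y) * (?n ?x + ?n ?y) \<le> vec_norm (?x - ?y) * 2"
    using mult_right_mono[OF diff, of "?n ?x + ?n ?y"]
      mult_left_mono[of "?n ?x + ?n ?y" 2 "vec_norm (?x - ?y)"] by simp
  moreover have "output_prob m U T Z b = (?n (network_state m U Z T))\<^sup>2" for Z
    by (simp add: output_prob_def L2_set_def sum_nonneg)
  ultimately show ?thesis
    by (simp add: power2_eq_square algebra_simps)
qed

theorem sensitivity_le_queries_square:
  assumes comp: "computes_bounded_error N f T m U" and len: "length X = N"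
    and I: "I \<subseteq> {..<N}" and sens: "\<And>i. i \<in> I \<Longrightarrow> f (X[i := \<not> X ! i]) \<noteq> f X"
  shows "real (card I) \<le> 144 * (real T)\<^sup>2"
proof -
  let ?w = "\<lambda>i t. query_weight m (index_bits N) i (network_state m U X t)"
  have fin: "finite I" using I finite_subset by auto
  have net: "quantum_network (length X) T m U"
    and prob: "\<And>X. length X = N \<Longrightarrow> 2 / 3 \<le> output_prob m U T X (f X)"
    using comp len by (auto simp: computes_bounded_error_def)
  \<comment> \<open>The output probabilities of \<open>f X\<close> differ by at least 2/3 - 1/3 =
    1/3. Measurement costs a factor 2 and the hybrid bound another 2, so the weights sum to at least
    1/12.\<close>
  have "1 / 12 \<le> (\<Sum>t<T. ?w i t)" if "i \<in> I" for i
  proof -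
    let ?Y = "X[i := \<not> X ! i]"
    have lenY: "length ?Y = length X" by simp
    have "f ?Y = (\<not> f X)" using sens[OF that] by simp
    then have "output_prob m U T ?Y (f X) \<le> 1 / 3"
      using output_prob_add[of ?Y T m U "f X"] net prob[of ?Y] len by simp
    then have "1 / 3 \<le> 2 * vec_norm (network_state m U X T - network_state m U ?Y T)"
      using output_prob_diff_le[OF net lenY, of "f X"] prob[OF len] by simp
    then show ?thesis
      using network_state_diff_le[OF net lenY, of i T] len by simp
  qed
  then have "(\<Sum>i\<in>I. 1 / 12) \<le> (\<Sum>i\<in>I. \<Sum>t<T. ?w i t)"
    by (rule sum_mono)
  \<comment> \<open>All weights refer to the run on the one input \<open>X\<close>, so at each time
    the sum over \<open>i\<close> concerns a single unit vector.\<close>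
  also have "\<dots> = (\<Sum>t<T. \<Sum>i\<in>I. ?w i t)"
    by (rule sum.swap)
  also have "\<dots> \<le> (\<Sum>t<T. sqrt (card I))"
    using sum_query_weight_le[OF network_state_carrier[OF net] fin] vec_norm_network_state[OF net]
    by (intro sum_mono) (metis lessThan_iff less_imp_le mult.right_neutral)
  finally have le: "real (card I) \<le> 12 * T * sqrt (card I)" by simp
  show ?thesis
  proof (cases "card I = 0")
    case False
    then have "sqrt (card I) * sqrt (card I) \<le> 12 * T * sqrt (card I)"
      using le by simp
    then have "sqrt (card I) \<le> 12 * T"
      by (rule mult_right_le_imp_le) (use False in simp)
    then have "(sqrt (card I))\<^sup>2 \<le> (12 * real T)\<^sup>2"
      by (intro power_mono) auto
    then show ?thesis by (simp add: power_mult_distrib)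
  qed simp
qed

section \<open>A network that reads the whole input\<close>

lemma extend_to_permutation:
  fixes n :: nat
  assumes "inj_on f A" "inj_on g A" "f ` A \<subseteq> {..<n}" "g ` A \<subseteq> {..<n}"
  shows "\<exists>\<pi>. bij_betw \<pi> {..<n} {..<n} \<and> (\<forall>a\<in>A. \<pi> (f a) = g a)"
proof -
  \<comment> \<open>The images have equal size, hence so do their complements, and any bijection
    \<open>h\<close> between these completes the map. Thus a unitary need only be prescribed on the
    basis states that occur.\<close>
  have "card ({..<n} - f ` A) = card ({..<n} - g ` A)"
    using assms by (simp add: card_Diff_subset finite_subset card_image)
  then have "\<exists>h. bij_betw h ({..<n} - f ` A) ({..<n} - g ` A)"
    by (intro finite_same_card_bij) simp_all
  then obtain h where h: "bij_betw h ({..<n} - f ` A) ({..<n} - g ` A)"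
    by blast
  define \<pi> where "\<pi> s = (if s \<in> f ` A then g (the_inv_into A f s) else h s)" for s
  have \<pi>: "\<pi> (f a) = g a" if "a \<in> A" for a
    using that assms(1) by (simp add: \<pi>_def the_inv_into_f_f)
  have "bij_betw \<pi> (f ` A) (g ` A)"
    unfolding bij_betw_def
  proof
    show "inj_on \<pi> (f ` A)"
      using \<pi> assms(2) by (auto simp: inj_on_def)
    show "\<pi> ` f ` A = g ` A"
      using \<pi> by (simp add: image_image)
  qed
  moreover have "bij_betw \<pi> ({..<n} - f ` A) ({..<n} - g ` A)"
    using h by (subst bij_betw_cong[where g = h]) (auto simp: \<pi>_def)
  ultimately have "bij_betw \<pi> (f ` A \<union> ({..<n} - f ` A)) (g ` A \<union> ({..<n} - g ` A))"
    by (rule bij_betw_combine) auto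
  moreover have "f ` A \<union> ({..<n} - f ` A) = {..<n}" "g ` A \<union> ({..<n} - g ` A) = {..<n}"
    using assms by auto
  ultimately show ?thesis using \<pi> by (intro exI[of _ \<pi>]) simp
qed

lemma horner_sum_of_bool_less:
  "(horner_sum of_bool 2 xs :: nat) < 2 ^ length xs"
  by (induction xs) auto

text \<open>The parity of the code is the first bit, so the bits can be peeled off one by
  one.\<close>

lemma horner_sum_of_bool_inject:
  "length xs = length ys \<Longrightarrow>
    (horner_sum of_bool 2 xs :: nat) = horner_sum of_bool 2 ys \<Longrightarrow> xs = ys"
proof (induction xs ys rule: list_induct2)
  case (Cons x xs y ys)
  have "even (horner_sum of_bool 2 (x # xs) :: nat) = even (horner_sum of_bool 2 (y # ys) :: nat)"
    using Cons.prems by simp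
  then have "x = y" by (cases x; cases y) simp_all
  then show ?case using Cons by simp
qed simp

lemma le_two_power_index_bits:
  assumes "1 \<le> N"
  shows "N \<le> 2 ^ index_bits N"
proof -
  have "log 2 (real N) \<le> real (index_bits N)"
    unfolding index_bits_def by linarith
  then have "real N \<le> 2 powr real (index_bits N)"
    using assms by (simp add: log_le_iff)
  then have "real N \<le> real (2 ^ index_bits N)"
    by (simp add: powr_realpow)
  then show ?thesis by (simp only: of_nat_le_iff)
qed

text \<open>XOR of numbers without common binary digits is their OR, which is their sum.\<close>

lemma flip_bit_unset:
  fixes a :: nat
  assumes "\<not> bit a n"
  shows "flip_bit n a = a + 2 ^ n"
proof -
  include bit_operations_syntax
  have "a AND push_bit n 1 = 0"
    using assms by (intro bit_eqI) (auto simp: bit_and_iff bit_push_bit_iff bit_exp_iff)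
  then show ?thesis
    by (simp add: flip_bit_eq_xor disjunctive_xor_eq_or disjunctive_add_eq_or push_bit_eq_mult)
qed

lemma output_prob_unit_vec:
  assumes "network_state m U X T = unit_vec (2 ^ m) s" "s < 2 ^ m" "bit s 0 = b"
  shows "output_prob m U T X b = 1"
proof -
  have "output_prob m U T X b = (\<Sum>r | r < 2 ^ m \<and> bit r 0 = b. if r = s then 1 else 0)"
    unfolding output_prob_def assms(1) by (intro sum.cong) (auto simp: unit_vec_def)
  then show ?thesis using assms by simp
qed

text \<open>Without some network, the LEAST in \<^const>\<open>Q2\<close> would be a junk value.  The witness reads
  the whole input: before query j its basis state is |j,0,z> with z the
  binary code of the first j bits, and U (j + 1) appends the answer to z.\<close>

lemma bounded_error_network_exists:
  assumes "1 \<le> N"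
  shows "\<exists>m U. computes_bounded_error N f N m U"
proof -
  define k where "k = index_bits N"
  \<comment> \<open>The layout is \<open>k\<close> index bits, one answer bit and \<open>N\<close>
    work bits. Hence \<open>m - k = N + 1\<close>: the index starts at bit \<open>N + 1\<close> and
    the answer is bit \<open>N\<close>.\<close>
  define m where "m = k + 1 + N"
  define code :: "bool list \<Rightarrow> nat" where "code xs = horner_sum of_bool 2 xs" for xs
  \<comment> \<open>\<open>pre xs\<close> is the state about to query bit \<open>length xs\<close>,
    with \<open>xs\<close> already read. \<open>post xs\<close> is the state just after the query
    that answered \<open>last xs\<close>. The next unitary has to map \<open>post xs\<close> to
    \<open>tgt xs\<close>. After the last query, \<open>tgt\<close> puts \<open>f xs\<close> into
    the rightmost bit and retains the code, which keeps it injective.\<close>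
  define pre where "pre xs = length xs * 2 ^ (N + 1) + code xs" for xs
  define tgt where "tgt xs = (if length xs < N then pre xs else 2 * code xs + of_bool (f xs))" for xs :: "bool list"
  define post where "post xs = pre (butlast xs) + (if last xs then 2 ^ N else 0)" for xs
  have code_less: "code xs < 2 ^ N" if "length xs \<le> N" for xs
    using horner_sum_of_bool_less[of xs] power_increasing[OF that, of "2::nat"]
    by (auto simp: code_def intro: less_le_trans)
  have code_inj: "xs = ys" if "length xs = length ys" "code xs = code ys" for xs ys
    using that horner_sum_of_bool_inject by (simp add: code_def)
  have pow: "2 ^ m = 2 ^ k * (2 ^ (N + 1) :: nat)"
    by (simp add: m_def power_add)
  \<comment> \<open>The slack \<open>2 ^ N\<close> leaves room for the answer bit, so that
    \<open>post_less\<close> follows as well.\<close>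
  have pre_less: "pre xs + 2 ^ N < 2 ^ m" if "length xs < N" for xs
  proof -
    have "Suc (length xs) * 2 ^ (N + 1) \<le> 2 ^ m"
      unfolding pow using that le_two_power_index_bits[OF assms]
      by (intro mult_right_mono) (auto simp: k_def)
    then show ?thesis using code_less[of xs] that by (simp add: pre_def)
  qed
  have tgt_less: "tgt xs < 2 ^ m" if "length xs \<le> N" for xs
  proof -
    have "2 * code xs + of_bool (f xs) < 2 ^ (N + 1)"
      using code_less[OF that] by (cases "f xs") auto
    also have "\<dots> \<le> 2 ^ m"
      by (intro power_increasing) (auto simp: m_def)
    finally show ?thesis using pre_less[of xs] by (auto simp: tgt_def)
  qed
  \<comment> \<open>Each unitary belongs to a fixed time, so injectivity is required only among
    lists of one length.\<close>
  have tgt_inj: "inj_on tgt {xs. length xs = j}" for j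
  proof (rule inj_onI)
    fix xs ys :: "bool list"
    assume "xs \<in> {xs. length xs = j}" "ys \<in> {xs. length xs = j}"
    then have len: "length xs = length ys" by simp
    assume "tgt xs = tgt ys"
    then have "code xs = code ys"
      using len by (cases "f xs"; cases "f ys"; simp add: tgt_def pre_def split: if_splits; presburger)
    then show "xs = ys" using len code_inj by simp
  qed
  have post_less: "post xs < 2 ^ m" if "length xs = Suc j" "j < N" for xs j
    using pre_less[of "butlast xs"] that by (simp add: post_def)
  have post_inj: "inj_on post {xs. length xs = Suc j}" if "j < N" for j
  proof (rule inj_onI)
    fix xs ys :: "bool list"
    assume "xs \<in> {xs. length xs = Suc j}" "ys \<in> {xs. length xs = Suc j}"
    then have len: "length xs = Suc j" "length ys = Suc j" by auto
    then obtain xs' x ys' y where xs: "xs = xs' @ [x]" and ys: "ys = ys' @ [y]"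
      by (cases xs rule: rev_cases; cases ys rule: rev_cases) auto
    assume "post xs = post ys"
    \<comment> \<open>Both codes lie below \<open>2 ^ N\<close>, so the answer bit and the code can
      be recovered from the sum.\<close>
    then have eq: "code xs' + (if x then 2 ^ N else 0) = code ys' + (if y then 2 ^ N else 0)"
      using len by (simp add: post_def pre_def xs ys)
    have "code xs' < 2 ^ N" "code ys' < 2 ^ N"
      using that len by (auto simp: xs ys intro!: code_less)
    with eq have "code xs' = code ys' \<and> x = y"
      by (cases x; cases y) simp_all
    then show "xs = ys"
      using len code_inj[of xs' ys'] by (simp add: xs ys)
  qed
  have "\<exists>\<pi>. bij_betw \<pi> {..<2 ^ m} {..<2 ^ m} \<and>
      (\<forall>xs\<in>{xs. length xs = Suc j}. \<pi> (post xs) = tgt xs)" if "j < N" for j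
  proof (rule extend_to_permutation)
    show "inj_on post {xs. length xs = Suc j}" "inj_on tgt {xs. length xs = Suc j}"
      using that by (rule post_inj) (rule tgt_inj)
    show "post ` {xs. length xs = Suc j} \<subseteq> {..<2 ^ m}"
    proof (rule image_subsetI)
      fix xs :: "bool list" assume "xs \<in> {xs. length xs = Suc j}"
      then show "post xs \<in> {..<2 ^ m}" using post_less[of xs j] that by simp
    qed
    show "tgt ` {xs. length xs = Suc j} \<subseteq> {..<2 ^ m}"
    proof (rule image_subsetI)
      fix xs :: "bool list" assume "xs \<in> {xs. length xs = Suc j}"
      then show "tgt xs \<in> {..<2 ^ m}" using tgt_less[of xs] that by simp
    qed
  qed
  then have "\<forall>j\<in>{..<N}. \<exists>\<pi>. bij_betw \<pi> {..<2 ^ m} {..<2 ^ m} \<and>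
      (\<forall>xs\<in>{xs. length xs = Suc j}. \<pi> (post xs) = tgt xs)"
    by blast
  from bchoice[OF this] obtain \<pi> where \<pi>: "\<And>j. j < N \<Longrightarrow> bij_betw (\<pi> j) {..<2 ^ m} {..<2 ^ m}"
    "\<And>j xs. j < N \<Longrightarrow> length xs = Suc j \<Longrightarrow> \<pi> j (post xs) = tgt xs"
    by auto
  \<comment> \<open>The identity suffices at time 0: since \<open>N\<close> is positive,
    \<open>tgt []\<close> is \<open>pre []\<close>, which is the initial state 0.\<close>
  define U where "U j = perm_mat (2 ^ m) (case j of 0 \<Rightarrow> id | Suc j' \<Rightarrow> \<pi> j')" for j
  have net: "quantum_network N N m U"
    using \<pi>(1) unfolding quantum_network_def U_def
    by (auto simp: m_def[symmetric] k_def[symmetric] intro!: unitary_perm_mat split: nat.split)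
      (simp add: m_def)
  have query: "query_basis m X (pre (take j X)) = post (take (Suc j) X)"
    if "length X = N" "j < N" for X j
  proof -
    have less: "code (take j X) < 2 ^ N"
      using that by (intro code_less) simp
    have "pre (take j X) div 2 ^ (N + 1) = j"
      using less that by (simp add: pre_def)
    moreover have "\<not> bit (pre (take j X)) N"
    proof -
      have "pre (take j X) = code (take j X) + 2 ^ N * (2 * j)"
        using that by (simp add: pre_def)
      then have "pre (take j X) div 2 ^ N = 2 * j"
        using less by simp
      then show ?thesis by (simp add: bit_iff_odd)
    qed
    ultimately have "query_basis m X (pre (take j X)) = pre (take j X) + (if X ! j then 2 ^ N else 0)"
      using that by (simp add: query_basis_def Let_def drop_bit_eq_div m_def k_def flip_bit_unset)
    then show ?thesis
      using that by (simp add: post_def take_Suc_conv_app_nth)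
  qed
  \<comment> \<open>On every input the run stays in a single basis state, so its output is
    certain.\<close>
  have state: "network_state m U X j = unit_vec (2 ^ m) (tgt (take j X))"
    if "length X = N" "j \<le> N" for X j
    using that(2)
  proof (induction j)
    case 0
    have "tgt [] = 0"
      using assms by (simp add: tgt_def pre_def code_def)
    then show ?case
      by (simp add: U_def perm_mat_unit_vec)
  next
    case (Suc j)
    then have j: "j < N" by simp
    have "query_op m X *\<^sub>v network_state m U X j = unit_vec (2 ^ m) (post (take (Suc j) X))"
    proof -
      have m: "index_bits (length X) + 1 \<le> m"
        using that by (simp add: m_def k_def)
      have "tgt (take j X) = pre (take j X)"
        using that j by (simp add: tgt_def)
      then show ?thesis
        using Suc.IH j that tgt_less[of "take j X"]
        by (simp add: query_op_perm_mat perm_mat_unit_vec[OF bij_query_basis[OF m]] query)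
    qed
    moreover have "U (Suc j) = perm_mat (2 ^ m) (\<pi> j)"
      by (simp add: U_def)
    ultimately show ?case
      using j that post_less[of "take (Suc j) X" j] \<pi>(2)[of j "take (Suc j) X"]
      by (simp add: perm_mat_unit_vec[OF \<pi>(1)])
  qed
  have "2 / 3 \<le> output_prob m U N X (f X)" if "length X = N" for X
  proof -
    have "output_prob m U N X (f X) = 1"
      using state[OF that, of N] that tgt_less[of X]
      by (intro output_prob_unit_vec[of _ _ _ _ "tgt X"]) (auto simp: tgt_def bit_0)
    then show ?thesis by simp
  qed
  then show ?thesis
    using net unfolding computes_bounded_error_def by blast
qed

section \<open>Hamming weight and the sensitivity of symmetric functions\<close>

lemma hamming_weight_update:
  assumes "i < length X"
  shows "X ! i \<Longrightarrow> hamming_weight X = Suc (hamming_weight (X[i := False]))"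
    and "\<not> X ! i \<Longrightarrow> hamming_weight (X[i := True]) = Suc (hamming_weight X)"
proof -
  have rem: "{j. j < length X \<and> X[i := False] ! j} = {j. j < length X \<and> X ! j} - {i}"
    using assms by (auto simp: nth_list_update split: if_splits)
  have ins: "{j. j < length X \<and> X[i := True] ! j} = insert i {j. j < length X \<and> X ! j}"
    using assms by (auto simp: nth_list_update)
  show "hamming_weight X = Suc (hamming_weight (X[i := False]))" if "X ! i"
    unfolding hamming_weight_def length_list_update rem
    using assms that by (intro card.remove) auto
  show "hamming_weight (X[i := True]) = Suc (hamming_weight X)" if "\<not> X ! i"
    unfolding hamming_weight_def length_list_update ins
    using assms that by simp
qed

lemma hamming_weight_le: "hamming_weight X \<le> length X"
proof -
  have "card {i. i < length X \<and> X ! i} \<le> card {..<length X}"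
    by (intro card_mono) auto
  then show ?thesis by (simp add: hamming_weight_def)
qed

lemma hamming_weight_threshold:
  assumes "k \<le> N"
  shows "hamming_weight (map (\<lambda>i. i < k) [0..<N]) = k"
proof -
  have "{i. i < N \<and> map (\<lambda>i. i < k) [0..<N] ! i} = {..<k}"
    using assms by auto
  then show ?thesis by (simp add: hamming_weight_def)
qed

text \<open>Let \<open>f\<close> change between weights k and k + 1. Flipping any of the N - k zeros
  of an input of weight k changes \<open>f\<close>, and so does flipping any of the k + 1 ones of an
  input of weight k + 1. These counts add up to N + 1, so one of them is at least N/2.\<close>

lemma symmetric_sensitivity:
  assumes sym: "symmetric_fun N f"
    and nonconst: "length X = N" "length Y = N" "f X \<noteq> f Y"
  shows "\<exists>Z I. length Z = N \<and> I \<subseteq> {..<N} \<and> N \<le> 2 * card I \<and>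
    (\<forall>i\<in>I. f (Z[i := \<not> Z ! i]) \<noteq> f Z)"
proof -
  define Z where "Z k = map (\<lambda>i. i < k) [0..<N]" for k :: nat
  have len: "length (Z k) = N" for k by (simp add: Z_def)
  have weight_Z: "hamming_weight (Z k) = k" if "k \<le> N" for k
    using that by (simp add: Z_def hamming_weight_threshold)
  have fZ: "f W = f (Z (hamming_weight W))" if "length W = N" for W
    using sym that len weight_Z[of "hamming_weight W"] hamming_weight_le[of W]
    unfolding symmetric_fun_def by metis
  \<comment> \<open>Otherwise \<open>f\<close> takes the same value at all weights and is constant
    by symmetry.\<close>
  have "\<exists>k<N. f (Z k) \<noteq> f (Z (Suc k))"
  proof (rule ccontr)
    assume *: "\<not> ?thesis"
    have "f (Z k) = f (Z 0)" if "k \<le> N" for k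
      using that by (induction k) (use * in auto)
    then have "f W = f (Z 0)" if "length W = N" for W
      using fZ[OF that] hamming_weight_le[of W] that by metis
    then show False using nonconst by simp
  qed
  then obtain k where k: "k < N" "f (Z k) \<noteq> f (Z (Suc k))" by blast
  show ?thesis
  proof (cases "N \<le> 2 * (N - k)")
    case True
    show ?thesis
    proof (intro exI[of _ "Z k"] exI[of _ "{k..<N}"] conjI ballI)
      fix i assume i: "i \<in> {k..<N}"
      then have "\<not> Z k ! i" by (simp add: Z_def)
      then have "hamming_weight ((Z k)[i := True]) = Suc k"
        using hamming_weight_update(2)[of i "Z k"] i k weight_Z[of k] len \<open>\<not> Z k ! i\<close>
        by simp
      then show "f ((Z k)[i := \<not> Z k ! i]) \<noteq> f (Z k)"
        using k fZ[of "(Z k)[i := True]"] len \<open>\<not> Z k ! i\<close> by simp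
    qed (use len True in auto)
  next
    case False
    show ?thesis
    proof (intro exI[of _ "Z (Suc k)"] exI[of _ "{..k}"] conjI ballI)
      fix i assume i: "i \<in> {..k}"
      then have "Z (Suc k) ! i" using k by (simp add: Z_def)
      then have "hamming_weight ((Z (Suc k))[i := False]) = k"
        using hamming_weight_update(1)[of i "Z (Suc k)"] i k weight_Z[of "Suc k"] len \<open>Z (Suc k) ! i\<close>
        by simp
      then show "f ((Z (Suc k))[i := \<not> Z (Suc k) ! i]) \<noteq> f (Z (Suc k))"
        using k fZ[of "(Z (Suc k))[i := False]"] len \<open>Z (Suc k) ! i\<close> by simp
    qed (use len k False in auto)
  qed
qed

section \<open>Upper bounds on decision tree depth and the conclusion\<close>

lemma D_le: "D N f \<le> N"
  unfolding D_def using dt_computes_exists by (rule Least_le)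

lemma D_constant:
  assumes "\<And>X. length X = N \<Longrightarrow> f X = b"
  shows "D N f = 0"
proof -
  have "dt_computes N f (Leaf b)"
    using assms by (simp add: dt_computes_def)
  then have "\<exists>t. dt_computes N f t \<and> dt_depth t = 0"
    by (intro exI[of _ "Leaf b"]) simp
  then have "D N f \<le> 0"
    unfolding D_def by (rule Least_le)
  then show ?thesis by simp
qed

theorem mainTheorem3:
  shows "\<exists>c::real. c > 0 \<and>
    (\<forall>(N::nat) (f :: bool list \<Rightarrow> bool).
       N \<ge> 1 \<longrightarrow> symmetric_fun N f \<longrightarrow> real (D N f) \<le> c * (real (Q2 N f))\<^sup>2)"
\<comment> \<open>288 = 2 * 144: the factor 2 comes from a sensitive set of at least N/2 bits, 144
  from the sensitivity bound.\<close>
proof (intro exI[of _ "288 :: real"] conjI allI impI)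
  fix N :: nat and f :: "bool list \<Rightarrow> bool"
  assume N: "N \<ge> 1" and sym: "symmetric_fun N f"
  show "real (D N f) \<le> 288 * (real (Q2 N f))\<^sup>2"
  \<comment> \<open>A constant function has no sensitive input, but a single leaf computes it, so
    its \<open>D\<close> is 0.\<close>
  proof (cases "\<exists>b. \<forall>X. length X = N \<longrightarrow> f X = b")
    case True
    then obtain b where "\<And>X. length X = N \<Longrightarrow> f X = b" by blast
    then have "D N f = 0" by (rule D_constant)
    then show ?thesis by simp
  next
    case False
    then have "\<exists>X. length X = N \<and> f X \<noteq> f (replicate N True)" by blast
    then obtain X where X: "length X = N" "f X \<noteq> f (replicate N True)"
      by blast
    obtain Z I where Z: "length Z = N"
      and I: "I \<subseteq> {..<N}" "N \<le> 2 * card I" "\<And>i. i \<in> I \<Longrightarrow> f (Z[i := \<not> Z ! i]) \<noteq> f Z"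
      using symmetric_sensitivity[OF sym X(1) length_replicate X(2)] by auto
    have "\<exists>T m U. computes_bounded_error N f T m U"
      using bounded_error_network_exists[OF N] by blast
    then have "\<exists>m U. computes_bounded_error N f (Q2 N f) m U"
      unfolding Q2_def by (rule LeastI_ex)
    then obtain m U where "computes_bounded_error N f (Q2 N f) m U" by blast
    then have "real (card I) \<le> 144 * (real (Q2 N f))\<^sup>2"
      using Z I by (intro sensitivity_le_queries_square)
    then show ?thesis
      using D_le[of N f] I(2) by linarith
  qed
qed simp

end
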